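(* Let $\mathcal{G}_d$ be a directed graph with leader set $\mathfrak{S}$ such that every follower can be reached through a directed path from some leader. If the subgraph of $\mathcal{G}_d$ induced by the followers is balanced (within this subgraph, the in-degree of every vertex equals its out-degree), then $$\|G\|_{\infty,d}\le 2\,\|G\|_{\infty,u}.$$
   Context: Directed graphs $\mathcal{G}_d=(\mathcal{V},\mathcal{E})$ are finite, simple, unweighted and unidirectional: if there is an edge from $v_i$ to $v_j$ then there is none from $v_j$ to $v_i$. The adjacency matrix $A$ has $A_{ij}=1$ if there is a directed edge from $v_j$ to $v_i$ and $A_{ij}=0$ otherwise; the in-degree is $\Delta_i=\sum_j A_{ij}$; the Laplacian is $\mathcal{L}=D-A$ with $D=\mathrm{diag}(\Delta_1,\dots,\Delta_n)$. The leader set $\mathfrak{S}\subset\mathcal{V}$ is a nonempty set of vertices of in-degree zero; the remaining vertices $\mathcal{V}\setminus\mathfrak{S}\neq\emptyset$ are the followers. The grounded Laplacian $\mathcal{L}_{g,d}$ is obtained from $\mathcal{L}$ by deleting the rows and columns of the leaders. The undirected counterpart $\mathcal{G}_u$ of $\mathcal{G}_d$ is obtained by replacing every directed edge (including those from leaders) by an undirected edge; $\mathcal{L}_{g,u}$ is obtained from the ordinary Laplacian (degree matrix minus adjacency matrix) of $\mathcal{G}_u$ by deleting the rows and columns of the vertices of $\mathfrak{S}$. For the leader-follower dynamics $\dot{\psi}=-\mathcal{L}_g\psi+\mathcal{L}_{12}\psi_{\mathfrak{S}}(0)+w(t)$, $z=\psi$ (where $\mathcal{L}_g$ is $\mathcal{L}_{g,d}$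 or $\mathcal{L}_{g,u}$, $\psi_{\mathfrak{S}}(0)$ is the constant vector of leader states, and $\mathcal{L}_{12}$ captures the leaders' influence), the transfer function from $w$ to $z$ is $(sI+\mathcal{L}_g)^{-1}$, and the system $\mathcal{H}_\infty$ norms are $$\|G\|_{\infty,d}=\sup_{\omega\in\mathbb{R}}\sigma_{\max}\big((j\omega I+\mathcal{L}_{g,d})^{-1}\big),\qquad \|G\|_{\infty,u}=\sup_{\omega\in\mathbb{R}}\sigma_{\max}\big((j\omega I+\mathcal{L}_{g,u})^{-1}\big),$$ where $\sigma_{\max}$ is the largest singular value and $j$ is the imaginary unit. *)

theory Defs
  imports
    "Graph_Theory.Graph_Theory"
    "Jordan_Normal_Form.DL_Submatrix"
    "Jordan_Normal_Form.Gauss_Jordan_Elimination"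
    "Jordan_Normal_Form.Schur_Decomposition"
    "HOL-Library.Extended_Real"
begin

definition balanced :: "('a, 'b) pre_digraph \<Rightarrow> bool" where
  "balanced G \<longleftrightarrow> (\<forall>v \<in> verts G. in_degree G v = out_degree G v)"

text \<open>
  Row \<open>i\<close> of the adjacency matrix records the arcs entering \<open>i\<close>, so its row sums are in-degrees.
  On a symmetric digraph this is the usual symmetric adjacency matrix and the row sums are the
  undirected degrees; the undirected counterpart of a digraph is \<open>mk_symmetric\<close>.
\<close>

definition adjacency_mat :: "nat \<Rightarrow> nat pair_pre_digraph \<Rightarrow> real mat" where
  "adjacency_mat n G = mat n n (\<lambda>(i, j). if j \<rightarrow>\<^bsub>G\<^esub> i then 1 else 0)"

definition laplacian_mat :: "nat \<Rightarrow> nat pair_pre_digraph \<Rightarrow> real mat" where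
  "laplacian_mat n G =
     mat_diag n (\<lambda>i. \<Sum>j<n. adjacency_mat n G $$ (i, j)) - adjacency_mat n G"

definition grounded_laplacian :: "nat \<Rightarrow> nat pair_pre_digraph \<Rightarrow> nat set \<Rightarrow> real mat" where
  "grounded_laplacian n G S = submatrix (laplacian_mat n G) (pverts G - S) (pverts G - S)"

text \<open>
  \<open>mat_adjoint M * M\<close> is positive semidefinite, so its eigenvalues are real and nonnegative.
\<close>

definition singular_values :: "complex mat \<Rightarrow> real set" where
  "singular_values M = {sqrt (Re l) | l. eigenvalue (mat_adjoint M * M) l}"

definition sigma_max :: "complex mat \<Rightarrow> real" where
  "sigma_max M = Max (singular_values M)"

text \<open>
  \<open>transfer_fun L s\<close> is \<open>(s I + L)\<^sup>-\<^sup>1\<close>, and \<open>None\<close> where this inverse does not exist.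
  The norm is extended real, and a pole on the imaginary axis makes it infinite.
\<close>

definition transfer_fun :: "real mat \<Rightarrow> complex \<Rightarrow> complex mat option" where
  "transfer_fun L s = mat_inverse (s \<cdot>\<^sub>m 1\<^sub>m (dim_row L) + map_mat complex_of_real L)"

definition hinf_norm :: "real mat \<Rightarrow> ereal" where
  "hinf_norm L =
     (SUP \<omega> :: real. case transfer_fun L (\<i> * complex_of_real \<omega>) of
        None \<Rightarrow> \<infinity>
      | Some M \<Rightarrow> ereal (sigma_max M))"

end

theory Submission
  imports Defs "Jordan_Normal_Form.Spectral_Radius"
begin

text \<open>
  Let \<open>L\<close> and \<open>U\<close> be the grounded Laplacians of the directed graph and of its undirected
  counterpart, and let \<open>k\<^sub>i\<close> be the number of arcs from leaders into the follower \<open>i\<close>. Balancedness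
  of the follower subgraph makes the diagonal of \<open>U\<close> equal to twice the follower in-degree plus
  \<open>k\<^sub>i\<close>, so \<open>L + L\<^sup>T = U + diag k\<close> and \<open>2 Re \<langle>L x, x\<rangle> \<ge> \<langle>U x, x\<rangle> \<ge> t |x|\<^sup>2\<close>, where \<open>t\<close> is the least
  eigenvalue of the positive semidefinite matrix \<open>U\<close>. If \<open>t = 0\<close>, the undirected norm is infinite.
  Otherwise \<open>1 / t\<close> is a singular value of \<open>U\<^sup>-\<^sup>1\<close>, the transfer function at frequency zero, while
  \<open>|(j \<omega> I + L) x| \<ge> (t / 2) |x|\<close> for every \<open>\<omega>\<close> because \<open>j \<omega> I\<close> does not contribute to
  \<open>Re \<langle>(j \<omega> I + L) x, x\<rangle>\<close>.
\<close>

section \<open>The complex inner product and adjoints\<close>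

lemma cscalar_prod_sum:
  fixes A :: "complex mat"
  assumes "A \<in> carrier_mat m n" "x \<in> carrier_vec n" "y \<in> carrier_vec m"
  shows "(A *\<^sub>v x) \<bullet>c y = (\<Sum>i<m. \<Sum>j<n. A $$ (i, j) * x $ j * cnj (y $ i))"
  using assms by (auto simp: scalar_prod_def lessThan_atLeast0 sum_distrib_right intro!: sum.cong)

lemma smult_one_mat_mult_vec: "v \<in> carrier_vec n \<Longrightarrow> (k \<cdot>\<^sub>m 1\<^sub>m n) *\<^sub>v v = k \<cdot>\<^sub>v v"
  for k :: complex
  by (intro eq_vecI) simp_all

lemma dim_mat_adjoint [simp]:
  "dim_row (mat_adjoint A) = dim_col A" "dim_col (mat_adjoint A) = dim_row A"
  by (simp_all add: mat_adjoint_def)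

lemma mat_adjoint_carrier [simp, intro]:
  "A \<in> carrier_mat m n \<Longrightarrow> mat_adjoint A \<in> carrier_mat n m"
  by (metis carrier_matD carrier_matI dim_mat_adjoint)

lemma index_mat_adjoint:
  assumes "i < dim_col A" "j < dim_row A"
  shows "mat_adjoint A $$ (i, j) = conjugate (A $$ (j, i))"
  using assms by (simp add: mat_adjoint_def mat_of_rows_def)

lemma cscalar_prod_commute:
  fixes x y :: "complex vec"
  assumes "x \<in> carrier_vec n" "y \<in> carrier_vec n"
  shows "y \<bullet>c x = cnj (x \<bullet>c y)"
  using assms by (auto simp: scalar_prod_def mult_ac)

lemma cscalar_prod_adjoint:
  fixes A :: "complex mat"
  assumes A: "A \<in> carrier_mat m n" and x: "x \<in> carrier_vec n" and y: "y \<in> carrier_vec m"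
  shows "(A *\<^sub>v x) \<bullet>c y = x \<bullet>c (mat_adjoint A *\<^sub>v y)"
proof -
  have c: "mat_adjoint A *\<^sub>v y \<in> carrier_vec n"
    by (rule mult_mat_vec_carrier[OF mat_adjoint_carrier[OF A] y])
  have "x \<bullet>c (mat_adjoint A *\<^sub>v y) = cnj ((mat_adjoint A *\<^sub>v y) \<bullet>c x)"
    by (rule cscalar_prod_commute[OF c x])
  also have "\<dots> = (\<Sum>j<n. \<Sum>i<m. A $$ (i, j) * x $ j * cnj (y $ i))"
    using A by (simp add: cscalar_prod_sum[OF mat_adjoint_carrier[OF A] y x] index_mat_adjoint
        mult_ac)
  also have "\<dots> = (A *\<^sub>v x) \<bullet>c y"
    by (subst sum.swap) (simp add: cscalar_prod_sum[OF A x y])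
  finally show ?thesis ..
qed

lemma cscalar_prod_self:
  fixes x :: "complex vec"
  assumes "x \<in> carrier_vec n"
  shows "x \<bullet>c x = complex_of_real (\<Sum>i<n. (cmod (x $ i))\<^sup>2)"
  using assms by (auto simp: scalar_prod_def lessThan_atLeast0 complex_norm_square simp del: of_real_power)

lemma cscalar_prod_self_pos:
  fixes x :: "complex vec"
  assumes "x \<in> carrier_vec n" "x \<noteq> 0\<^sub>v n"
  shows "0 < Re (x \<bullet>c x)"
proof -
  have "x \<bullet>c x \<noteq> 0" using assms conjugate_square_eq_0_vec by blast
  moreover have "0 \<le> Re (x \<bullet>c x)" "Im (x \<bullet>c x) = 0"
    by (simp_all add: cscalar_prod_self[OF assms(1)] sum_nonneg)
  ultimately show ?thesis by (simp add: complex_eq_iff)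
qed

lemma Re_cscalar_prod_add_smult:
  fixes u v w z :: "complex vec" and a :: real
  assumes "u \<in> carrier_vec n" "v \<in> carrier_vec n" "w \<in> carrier_vec n" "z \<in> carrier_vec n"
  shows "Re ((u + complex_of_real a \<cdot>\<^sub>v v) \<bullet>c (w + complex_of_real a \<cdot>\<^sub>v z)) =
    Re (u \<bullet>c w) + a * Re (u \<bullet>c z) + a * Re (v \<bullet>c w) + a\<^sup>2 * Re (v \<bullet>c z)"
  using assms by (simp add: scalar_prod_def sum.distrib sum_distrib_left algebra_simps power2_eq_square)

section \<open>Quadratic forms and the least eigenvalue of a Hermitian matrix\<close>

text \<open>Each product of two coordinates of \<open>x\<close> is bounded by |x|^2, so the sum of
  the moduli of the entries is a crude bound. Only the existence of some \<open>B\<close> matters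
  later.\<close>

lemma cscalar_prod_bound:
  fixes A :: "complex mat"
  assumes A: "A \<in> carrier_mat n n"
  obtains B where "0 < B" "\<And>x. x \<in> carrier_vec n \<Longrightarrow> \<bar>Re ((A *\<^sub>v x) \<bullet>c x)\<bar> \<le> B * Re (x \<bullet>c x)"
proof
  let ?B = "\<Sum>i<n. \<Sum>j<n. cmod (A $$ (i, j))"
  \<comment> \<open>The added \<open>1\<close> keeps the bound positive even for the zero matrix;
    later arguments divide by it.\<close>
  show "0 < ?B + 1" by (simp add: add_nonneg_pos sum_nonneg)
  fix x :: "complex vec" assume x: "x \<in> carrier_vec n"
  let ?N = "\<Sum>i<n. (cmod (x $ i))\<^sup>2"
  have N: "0 \<le> ?N" by (simp add: sum_nonneg)
  have le: "cmod (x $ j) * cmod (x $ i) \<le> ?N" if "i < n" "j < n" for i j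
  proof -
    have "(cmod (x $ k))\<^sup>2 \<le> ?N" if "k < n" for k
      using that by (intro member_le_sum) auto
    then have "(cmod (x $ j))\<^sup>2 \<le> ?N" "(cmod (x $ i))\<^sup>2 \<le> ?N" using that by auto
    moreover have "2 * (cmod (x $ j) * cmod (x $ i)) \<le> (cmod (x $ j))\<^sup>2 + (cmod (x $ i))\<^sup>2"
      using sum_squares_bound[of "cmod (x $ j)" "cmod (x $ i)"] by (simp add: mult_ac)
    ultimately show ?thesis by linarith
  qed
  have "\<bar>Re ((A *\<^sub>v x) \<bullet>c x)\<bar> \<le> cmod ((A *\<^sub>v x) \<bullet>c x)" by (rule abs_Re_le_cmod)
  also have "\<dots> \<le> (\<Sum>i<n. \<Sum>j<n. cmod (A $$ (i, j) * x $ j * cnj (x $ i)))"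
    unfolding cscalar_prod_sum[OF A x x] by (intro order.trans[OF norm_sum] sum_mono norm_sum)
  also have "\<dots> \<le> (\<Sum>i<n. \<Sum>j<n. cmod (A $$ (i, j)) * ?N)"
    by (intro sum_mono) (simp add: norm_mult mult.assoc mult_left_mono[OF le])
  also have "\<dots> \<le> (?B + 1) * ?N" using N by (simp add: sum_distrib_right distrib_right)
  finally show "\<bar>Re ((A *\<^sub>v x) \<bullet>c x)\<bar> \<le> (?B + 1) * Re (x \<bullet>c x)"
    by (simp add: cscalar_prod_self[OF x])
qed

text \<open>Expand \<open>\<langle>P z, z\<rangle> \<ge> 0\<close> at \<open>z = x - M x / B\<close>.\<close>

lemma psd_inverse_coercive:
  fixes P M :: "complex mat"
  assumes P: "P \<in> carrier_mat n n" and herm: "mat_adjoint P = P"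
    and psd: "\<And>x. x \<in> carrier_vec n \<Longrightarrow> 0 \<le> Re ((P *\<^sub>v x) \<bullet>c x)"
    and M: "M \<in> carrier_mat n n" and inv: "P * M = 1\<^sub>m n"
    and B: "0 < B" "\<And>x. x \<in> carrier_vec n \<Longrightarrow> Re ((M *\<^sub>v x) \<bullet>c x) \<le> B * Re (x \<bullet>c x)"
    and x: "x \<in> carrier_vec n"
  shows "Re (x \<bullet>c x) \<le> B * Re ((P *\<^sub>v x) \<bullet>c x)"
proof -
  define y where "y = M *\<^sub>v x"
  \<comment> \<open>This value minimises \<open>2 * a + a^2 * B\<close>, the coefficient of |x|^2 in
    the bound below.\<close>
  define a where "a = - 1 / B"
  have y: "y \<in> carrier_vec n" using M x by (simp add: y_def)
  have Py: "P *\<^sub>v y = x"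
    using P M x inv by (metis assoc_mult_mat_vec one_mult_mat_vec y_def)
  have Px: "P *\<^sub>v x \<in> carrier_vec n" using P x by auto
  have "P *\<^sub>v (x + complex_of_real a \<cdot>\<^sub>v y) = P *\<^sub>v x + complex_of_real a \<cdot>\<^sub>v x"
    using P x y by (simp add: mult_add_distrib_mat_vec mult_mat_vec Py)
  \<comment> \<open>Because \<open>P\<close> is Hermitian and \<open>P y = x\<close>, both terms
    linear in \<open>a\<close> equal |x|^2.\<close>
  moreover have "(P *\<^sub>v x) \<bullet>c y = x \<bullet>c x" using cscalar_prod_adjoint[OF P x y] herm Py by simp
  moreover have "Re (x \<bullet>c y) = Re (y \<bullet>c x)" using cscalar_prod_commute[OF x y] by simp
  ultimately have "0 \<le> Re ((P *\<^sub>v x) \<bullet>c x) + 2 * a * Re (x \<bullet>c x) + a\<^sup>2 * Re (y \<bullet>c x)"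
    using psd[of "x + complex_of_real a \<cdot>\<^sub>v y"] x y
    by (simp add: Re_cscalar_prod_add_smult[OF Px x x y])
  also have "\<dots> \<le> Re ((P *\<^sub>v x) \<bullet>c x) + 2 * a * Re (x \<bullet>c x) + a\<^sup>2 * (B * Re (x \<bullet>c x))"
    using B(2)[OF x] by (simp add: y_def mult_left_mono)
  also have "\<dots> = Re ((P *\<^sub>v x) \<bullet>c x) - Re (x \<bullet>c x) / B"
    using B(1) by (simp add: a_def power2_eq_square field_simps)
  finally show ?thesis using B(1) by (simp add: field_simps)
qed

text \<open>
  The supremum \<open>t\<close> of the lower bounds of the Rayleigh quotient is an eigenvalue: otherwise
  \<open>H - t I\<close> would be invertible and positive semidefinite, hence coercive, and \<open>t\<close> could be increased.
\<close>

lemma hermitian_least_eigenvalue: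
  fixes H :: "complex mat"
  assumes H: "H \<in> carrier_mat n n" and herm: "mat_adjoint H = H" and n: "0 < n"
  obtains t :: real where "eigenvalue H (complex_of_real t)"
    "\<And>x. x \<in> carrier_vec n \<Longrightarrow> t * Re (x \<bullet>c x) \<le> Re ((H *\<^sub>v x) \<bullet>c x)"
proof -
  define T where "T = {t. \<forall>x \<in> carrier_vec n. t * Re (x \<bullet>c x) \<le> Re ((H *\<^sub>v x) \<bullet>c x)}"
  obtain C where C: "\<And>x. x \<in> carrier_vec n \<Longrightarrow> \<bar>Re ((H *\<^sub>v x) \<bullet>c x)\<bar> \<le> C * Re (x \<bullet>c x)"
    using cscalar_prod_bound[OF H] by blast
  have "- C \<in> T" using C by (force simp: T_def abs_le_iff)
  then have ne: "T \<noteq> {}" by auto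
  have quot: "t \<le> Re ((H *\<^sub>v x) \<bullet>c x) / Re (x \<bullet>c x)"
    if "t \<in> T" "x \<in> carrier_vec n" "x \<noteq> 0\<^sub>v n" for t x
    using that cscalar_prod_self_pos[of x n] by (auto simp: T_def field_simps)
  \<comment> \<open>Since \<open>0 < n\<close>, there is a nonzero vector, and its Rayleigh quotient
    bounds \<open>T\<close> above.\<close>
  have "unit_vec n 0 \<noteq> (0\<^sub>v n :: complex vec)"
    using n by (metis index_unit_vec(1) index_zero_vec(1) zero_neq_one)
  then have bdd: "bdd_above T"
    using quot[of _ "unit_vec n 0"] by (auto intro!: bdd_aboveI)
  define t where "t = Sup T"
  \<comment> \<open>The supremum is attained: every Rayleigh quotient is an upper bound of
    \<open>T\<close>, hence at least \<open>t\<close>.\<close>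
  have t: "t * Re (x \<bullet>c x) \<le> Re ((H *\<^sub>v x) \<bullet>c x)" if x: "x \<in> carrier_vec n" for x
  proof (cases "x = 0\<^sub>v n")
    case True
    then show ?thesis using H by (simp add: scalar_prod_def)
  next
    case False
    have "t \<le> Re ((H *\<^sub>v x) \<bullet>c x) / Re (x \<bullet>c x)"
      unfolding t_def using quot[OF _ x False] by (intro cSup_least[OF ne]) auto
    then show ?thesis using cscalar_prod_self_pos[OF x False] by (simp add: field_simps)
  qed
  \<comment> \<open>This is \<open>H - t I\<close>: Hermitian because \<open>t\<close> is real, and
    positive semidefinite because \<open>t\<close> lies in \<open>T\<close>.\<close>
  define P where "P = char_matrix H (complex_of_real t)"
  have P: "P \<in> carrier_mat n n" using H by (simp add: P_def)
  have RePx: "Re ((P *\<^sub>v x) \<bullet>c x) = Re ((H *\<^sub>v x) \<bullet>c x) - t * Re (x \<bullet>c x)"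
    if "x \<in> carrier_vec n" for x
  proof -
    have "P *\<^sub>v x = H *\<^sub>v x + complex_of_real (- t) \<cdot>\<^sub>v x"
      using H that by (simp add: P_def char_matrix_def add_mult_distrib_mat_vec[of _ n n] smult_one_mat_mult_vec)
    then show ?thesis
      using H that by (simp add: add_scalar_prod_distrib[where n = n])
  qed
  have hermP: "mat_adjoint P = P"
  proof (rule eq_matI)
    fix i j assume "i < dim_row P" "j < dim_col P"
    then have ij: "i < n" "j < n" using P by auto
    then have "conjugate (H $$ (j, i)) = H $$ (i, j)"
      using index_mat_adjoint[of i H j] herm H by simp
    then show "mat_adjoint P $$ (i, j) = P $$ (i, j)"
      using ij P H by (simp add: index_mat_adjoint) (simp add: P_def char_matrix_def)
  qed (use P in auto)
  have "eigenvalue H (complex_of_real t)"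
  proof (rule ccontr)
    assume "\<not> ?thesis"
    then have "det P \<noteq> 0" by (simp add: P_def eigenvalue_det[OF H])
    then obtain M where M: "M \<in> carrier_mat n n" "P * M = 1\<^sub>m n"
      using mat_inverse(1)[OF P] mat_inverse(2)[OF P] det_non_zero_imp_unit[OF P]
      by (metis option.exhaust)
    obtain B where B: "0 < B" "\<And>x. x \<in> carrier_vec n \<Longrightarrow> \<bar>Re ((M *\<^sub>v x) \<bullet>c x)\<bar> \<le> B * Re (x \<bullet>c x)"
      using cscalar_prod_bound[OF M(1)] by blast
    have "t + 1 / B \<in> T"
    proof -
      have "(t + 1 / B) * Re (x \<bullet>c x) \<le> Re ((H *\<^sub>v x) \<bullet>c x)" if x: "x \<in> carrier_vec n" for x
      proof -
        have "Re (x \<bullet>c x) \<le> B * Re ((P *\<^sub>v x) \<bullet>c x)"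
          using B t by (intro psd_inverse_coercive[OF P hermP _ M _ _ x]) (auto simp: RePx abs_le_iff)
        then show ?thesis using B(1) by (simp add: RePx[OF x] field_simps)
      qed
      then show ?thesis by (simp add: T_def)
    qed
    then have "t + 1 / B \<le> t" unfolding t_def by (rule cSup_upper[OF _ bdd])
    then show False using B(1) by simp
  qed
  then show ?thesis using t that by blast
qed

section \<open>Bounds on the largest singular value\<close>

lemma mat_adjoint_mult:
  fixes A B :: "complex mat"
  assumes A: "A \<in> carrier_mat m k" and B: "B \<in> carrier_mat k n"
  shows "mat_adjoint (A * B) = mat_adjoint B * mat_adjoint A"
proof (rule eq_matI)
  fix i j
  assume "i < dim_row (mat_adjoint B * mat_adjoint A)" "j < dim_col (mat_adjoint B * mat_adjoint A)"
  then have ij: "i < n" "j < m" using A B by auto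
  have "mat_adjoint (A * B) $$ (i, j) = (\<Sum>l = 0..<k. cnj (A $$ (j, l) * B $$ (l, i)))"
    using A B ij by (simp add: index_mat_adjoint scalar_prod_def)
  also have "\<dots> = (mat_adjoint B * mat_adjoint A) $$ (i, j)"
    using A B ij by (simp add: index_mat_adjoint scalar_prod_def mult.commute)
  finally show "mat_adjoint (A * B) $$ (i, j) = (mat_adjoint B * mat_adjoint A) $$ (i, j)" .
qed (use A B in auto)

lemma mat_adjoint_one: "mat_adjoint (1\<^sub>m n) = (1\<^sub>m n :: complex mat)"
  by (intro eq_matI) (auto simp: index_mat_adjoint)

lemma singular_values_eq: "singular_values A = (sqrt \<circ> Re) ` spectrum (mat_adjoint A * A)"
  by (auto simp: singular_values_def spectrum_def)

lemma finite_singular_values: "finite (singular_values A)"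
proof -
  have "mat_adjoint A * A \<in> carrier_mat (dim_col A) (dim_col A)" by auto
  then show ?thesis by (simp add: singular_values_eq card_finite_spectrum(1))
qed

text \<open>An eigenvector \<open>v\<close> of \<open>mat_adjoint A * A\<close> for \<open>l\<close>
  satisfies |A v|^2 = Re l |v|^2, so a norm bound on \<open>A\<close> bounds every singular
  value.\<close>

lemma sigma_max_le:
  assumes A: "A \<in> carrier_mat m n" and n: "0 < n" and c: "0 \<le> c"
    and le: "\<And>v. v \<in> carrier_vec n \<Longrightarrow> Re ((A *\<^sub>v v) \<bullet>c (A *\<^sub>v v)) \<le> c\<^sup>2 * Re (v \<bullet>c v)"
  shows "sigma_max A \<le> c"
proof -
  have AA: "mat_adjoint A * A \<in> carrier_mat n n" using A by auto
  have "s \<le> c" if s: "s \<in> singular_values A" for s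
  proof -
    obtain l v where l: "s = sqrt (Re l)" and ev: "eigenvector (mat_adjoint A * A) v l"
      using s by (auto simp: singular_values_def eigenvalue_def)
    have v: "v \<in> carrier_vec n" "v \<noteq> 0\<^sub>v n" and Av: "mat_adjoint A * A *\<^sub>v v = l \<cdot>\<^sub>v v"
      using ev AA A by (auto simp: eigenvector_def)
    have "(A *\<^sub>v v) \<bullet>c (A *\<^sub>v v) = v \<bullet>c (mat_adjoint A * A *\<^sub>v v)"
      using cscalar_prod_adjoint[OF A v(1) mult_mat_vec_carrier[OF A v(1)]]
        assoc_mult_mat_vec[OF mat_adjoint_carrier[OF A] A v(1)] by simp
    \<comment> \<open>As |v|^2 is real, passing to real parts turns \<open>cnj l\<close> into
      \<open>Re l\<close>.\<close>
    also have "\<dots> = cnj l * (v \<bullet>c v)"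
      using v(1) by (simp add: Av conjugate_smult_vec)
    finally have "Re l * Re (v \<bullet>c v) \<le> c\<^sup>2 * Re (v \<bullet>c v)"
      using le[OF v(1)] by (simp add: cscalar_prod_self[OF v(1)])
    then have "Re l \<le> c\<^sup>2" using cscalar_prod_self_pos[OF v] by simp
    then show ?thesis unfolding l using c by (rule real_le_lsqrt[rotated])
  qed
  \<comment> \<open>\<open>Max\<close> is meaningful only on a nonempty set; \<open>0 < n\<close>
    enters here.\<close>
  moreover have "singular_values A \<noteq> {}"
    using spectrum_non_empty[OF AA n] by (simp add: singular_values_eq)
  ultimately show ?thesis by (simp add: sigma_max_def finite_singular_values)
qed

text \<open>An eigenvector of \<open>H\<close> for \<open>t\<close> is an eigenvector of both
  \<open>M\<close> and \<open>mat_adjoint M\<close> for \<open>1 / t\<close>, which makes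
  \<open>1 / t^2\<close> an eigenvalue of \<open>mat_adjoint M * M\<close>.\<close>

lemma sigma_max_hermitian_inverse_ge:
  fixes t :: real
  assumes H: "H \<in> carrier_mat n n" and herm: "mat_adjoint H = H"
    and M: "M \<in> carrier_mat n n" and inv: "H * M = 1\<^sub>m n" "M * H = 1\<^sub>m n"
    and t: "0 < t" "eigenvalue H (complex_of_real t)"
  shows "1 / t \<le> sigma_max M"
proof -
  let ?a = "complex_of_real (1 / t)"
  obtain v where v: "v \<in> carrier_vec n" "v \<noteq> 0\<^sub>v n" and Hv: "H *\<^sub>v v = complex_of_real t \<cdot>\<^sub>v v"
    using t(2) H by (auto simp: eigenvalue_def eigenvector_def)
  \<comment> \<open>Stated for any left inverse \<open>N\<close>, to be used for \<open>M\<close>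
    and for its adjoint.\<close>
  have inv_v: "N *\<^sub>v v = ?a \<cdot>\<^sub>v v" if N: "N \<in> carrier_mat n n" "N * H = 1\<^sub>m n" for N
  proof -
    have "complex_of_real t \<cdot>\<^sub>v (N *\<^sub>v v) = N *\<^sub>v (H *\<^sub>v v)"
      using N(1) v(1) by (simp add: Hv mult_mat_vec)
    also have "\<dots> = v" using N H v(1) by (metis assoc_mult_mat_vec one_mult_mat_vec)
    finally have "?a \<cdot>\<^sub>v v = (?a * complex_of_real t) \<cdot>\<^sub>v (N *\<^sub>v v)"
      by (metis smult_smult_assoc)
    then show ?thesis using t(1) by simp
  qed
  have "mat_adjoint M * H = 1\<^sub>m n"
    using mat_adjoint_mult[OF H M] by (simp add: inv herm mat_adjoint_one)
  then have "mat_adjoint M *\<^sub>v v = ?a \<cdot>\<^sub>v v" "M *\<^sub>v v = ?a \<cdot>\<^sub>v v"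
    using inv_v M inv(2) by blast+
  then have "mat_adjoint M * M *\<^sub>v v = (?a * ?a) \<cdot>\<^sub>v v"
    using assoc_mult_mat_vec[OF mat_adjoint_carrier[OF M] M v(1)] M v(1)
    by (simp add: mult_mat_vec[OF mat_adjoint_carrier[OF M] v(1)] smult_smult_assoc)
  then have "eigenvalue (mat_adjoint M * M) (?a * ?a)"
    using v M by (auto simp: eigenvalue_def eigenvector_def)
  then have "sqrt (Re (?a * ?a)) \<in> singular_values M"
    unfolding singular_values_def by blast
  then have "1 / t \<in> singular_values M" using t(1) by (simp add: real_sqrt_divide)
  then show ?thesis by (simp add: sigma_max_def finite_singular_values)
qed

section \<open>Upper and lower bounds on the H-infinity norm\<close>

text \<open>Coercivity survives adding an imaginary multiple of the identity and yields |K x| >= c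
  |x|; at \<open>x = M v\<close> this bounds the inverse \<open>M\<close> by \<open>1 / c\<close>,
  uniformly in the frequency.\<close>

lemma hinf_norm_le_of_coercive:
  fixes L :: "real mat"
  assumes L: "L \<in> carrier_mat n n" and n: "0 < n" and c: "0 < c"
    and le: "\<And>x. x \<in> carrier_vec n \<Longrightarrow>
      c * Re (x \<bullet>c x) \<le> Re ((map_mat complex_of_real L *\<^sub>v x) \<bullet>c x)"
  shows "hinf_norm L \<le> ereal (1 / c)"
  unfolding hinf_norm_def
proof (rule SUP_least)
  fix \<omega> :: real
  let ?R = "map_mat complex_of_real L"
  let ?s = "\<i> * complex_of_real \<omega>"
  define K where "K = ?s \<cdot>\<^sub>m 1\<^sub>m (dim_row L) + ?R"
  have R: "?R \<in> carrier_mat n n" and K: "K \<in> carrier_mat n n" using L by (auto simp: K_def)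
  have K_ge: "c\<^sup>2 * Re (x \<bullet>c x) \<le> Re ((K *\<^sub>v x) \<bullet>c (K *\<^sub>v x))" if x: "x \<in> carrier_vec n" for x
  proof -
    have Rx: "?R *\<^sub>v x \<in> carrier_vec n" and Kx: "K *\<^sub>v x \<in> carrier_vec n" using R K x by auto
    have "K *\<^sub>v x = ?s \<cdot>\<^sub>v x + ?R *\<^sub>v x"
      using L R x by (simp add: K_def add_mult_distrib_mat_vec[of _ n n] smult_one_mat_mult_vec)
    then have "Re ((K *\<^sub>v x) \<bullet>c x) = Re ((?R *\<^sub>v x) \<bullet>c x)"
      using x Rx by (simp add: add_scalar_prod_distrib[where n = n] cscalar_prod_self[OF x])
    then have "c * Re (x \<bullet>c x) \<le> Re ((K *\<^sub>v x) \<bullet>c x)" using le[OF x] by simp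
    then have *: "c * (c * Re (x \<bullet>c x)) \<le> c * Re ((K *\<^sub>v x) \<bullet>c x)"
      using c by simp
    \<comment> \<open>Expanding |K x - c x|^2 >= 0 gives |K x|^2 >= 2 c Re <K x, x> - c^2 |x|^2,
      which is at least c^2 |x|^2 by coercivity.\<close>
    let ?z = "K *\<^sub>v x + complex_of_real (- c) \<cdot>\<^sub>v x"
    have z: "?z \<in> carrier_vec n" using Kx x by auto
    have "0 \<le> Re (?z \<bullet>c ?z)"
      unfolding cscalar_prod_self[OF z] by (simp add: sum_nonneg)
    also have "Re (?z \<bullet>c ?z) = Re ((K *\<^sub>v x) \<bullet>c (K *\<^sub>v x)) - 2 * (c * Re ((K *\<^sub>v x) \<bullet>c x))
        + c\<^sup>2 * Re (x \<bullet>c x)"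
      unfolding Re_cscalar_prod_add_smult[OF Kx x Kx x]
      using cscalar_prod_commute[OF x Kx] by simp
    finally show ?thesis using * by (simp add: power2_eq_square)
  qed
  \<comment> \<open>The lower bound forces a trivial kernel, so no frequency takes the value
    \<infinity>.\<close>
  have "det K \<noteq> 0"
  proof
    assume "det K = 0"
    then obtain x where x: "x \<in> carrier_vec n" "x \<noteq> 0\<^sub>v n" "K *\<^sub>v x = 0\<^sub>v n"
      using det_0_iff_vec_prod_zero_field[OF K] by blast
    then have "c\<^sup>2 * Re (x \<bullet>c x) \<le> 0" using K_ge[OF x(1)] by simp
    then show False using c cscalar_prod_self_pos[OF x(1,2)] by (simp add: mult_le_0_iff)
  qed
  then obtain M where M: "mat_inverse K = Some M"
    using mat_inverse(1)[OF K] det_non_zero_imp_unit[OF K] by (metis option.exhaust)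
  then have KM: "K * M = 1\<^sub>m n" and Mc: "M \<in> carrier_mat n n" using mat_inverse(2)[OF K] by auto
  have "sigma_max M \<le> 1 / c"
  proof (rule sigma_max_le[OF Mc n])
    fix v :: "complex vec" assume v: "v \<in> carrier_vec n"
    have "K *\<^sub>v (M *\<^sub>v v) = v" using K Mc v KM by (metis assoc_mult_mat_vec one_mult_mat_vec)
    then show "Re ((M *\<^sub>v v) \<bullet>c (M *\<^sub>v v)) \<le> (1 / c)\<^sup>2 * Re (v \<bullet>c v)"
      using K_ge[OF mult_mat_vec_carrier[OF Mc v]] c by (simp add: field_simps)
  qed (use c in simp)
  then show "(case transfer_fun L ?s of None \<Rightarrow> \<infinity> | Some M \<Rightarrow> ereal (sigma_max M)) \<le> ereal (1 / c)"
    by (simp add: transfer_fun_def K_def[symmetric] M)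
qed

text \<open>A case rule, so that a single \<open>t\<close> is both a coercivity constant of
  \<open>U\<close> and the reciprocal of a lower bound for the norm. That \<open>t\<close> is the
  least eigenvalue of \<open>U\<close>.\<close>

lemma hinf_norm_ge_of_psd:
  fixes U :: "real mat"
  assumes U: "U \<in> carrier_mat n n" and n: "0 < n"
    and sym: "\<And>i j. i < n \<Longrightarrow> j < n \<Longrightarrow> U $$ (i, j) = U $$ (j, i)"
    and psd: "\<And>x. x \<in> carrier_vec n \<Longrightarrow> 0 \<le> Re ((map_mat complex_of_real U *\<^sub>v x) \<bullet>c x)"
  obtains (singular) "hinf_norm U = \<infinity>"
  | (coercive) t where "0 < t" "ereal (1 / t) \<le> hinf_norm U"
      "\<And>x. x \<in> carrier_vec n \<Longrightarrow>
        t * Re (x \<bullet>c x) \<le> Re ((map_mat complex_of_real U *\<^sub>v x) \<bullet>c x)"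
proof -
  let ?H = "map_mat complex_of_real U"
  have H: "?H \<in> carrier_mat n n" using U by simp
  have herm: "mat_adjoint ?H = ?H"
    using U sym by (intro eq_matI) (auto simp: index_mat_adjoint)
  \<comment> \<open>At frequency zero the transfer function is the inverse of \<open>U\<close>; this
    one value bounds the supremum from below.\<close>
  have "?H = \<i> * complex_of_real 0 \<cdot>\<^sub>m 1\<^sub>m (dim_row U) + ?H"
    using U by (intro eq_matI) auto
  then have "transfer_fun U (\<i> * complex_of_real 0) = mat_inverse ?H"
    by (simp add: transfer_fun_def)
  then have hinf: "(case mat_inverse ?H of None \<Rightarrow> \<infinity> | Some M \<Rightarrow> ereal (sigma_max M)) \<le> hinf_norm U"
    unfolding hinf_norm_def by (metis (no_types, lifting) SUP_upper UNIV_I)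
  show ?thesis
  proof (cases "mat_inverse ?H")
    case None
    then show ?thesis using hinf by (intro singular) simp
  next
    case (Some M)
    then have M: "M \<in> carrier_mat n n" "?H * M = 1\<^sub>m n" "M * ?H = 1\<^sub>m n"
      using mat_inverse(2)[OF H] by auto
    obtain t where t: "eigenvalue ?H (complex_of_real t)"
      "\<And>x. x \<in> carrier_vec n \<Longrightarrow> t * Re (x \<bullet>c x) \<le> Re ((?H *\<^sub>v x) \<bullet>c x)"
      using hermitian_least_eigenvalue[OF H herm n] by blast
    obtain v where v: "v \<in> carrier_vec n" "v \<noteq> 0\<^sub>v n" "?H *\<^sub>v v = complex_of_real t \<cdot>\<^sub>v v"
      using t(1) H by (auto simp: eigenvalue_def eigenvector_def)
    have "0 \<le> t * Re (v \<bullet>c v)" using psd[OF v(1)] v by simp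
    then have "0 \<le> t" using cscalar_prod_self_pos[OF v(1,2)] by (simp add: zero_le_mult_iff)
    \<comment> \<open>Otherwise \<open>v\<close> would lie in the kernel of an invertible
      matrix.\<close>
    moreover have "t \<noteq> 0"
    proof
      assume "t = 0"
      then have "?H *\<^sub>v v = 0\<^sub>v n" using v by auto
      then have "v = M *\<^sub>v 0\<^sub>v n" using M H v(1) by (metis assoc_mult_mat_vec one_mult_mat_vec)
      then show False using M(1) v(2) by auto
    qed
    ultimately have "0 < t" by simp
    moreover have "ereal (1 / t) \<le> hinf_norm U"
      using sigma_max_hermitian_inverse_ge[OF H herm M(1,2,3) \<open>0 < t\<close> t(1)] hinf Some
      by (auto intro: order.trans[rotated])
    ultimately show ?thesis using t(2) by (rule coercive)
  qed
qed

section \<open>Quadratic forms of Laplacian type\<close>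

text \<open>The diagonal \<open>d\<close> is kept apart from the row sums of \<open>w\<close>, as a
  grounded Laplacian also counts arcs from leaders there. With \<open>w\<close> arbitrary, both
  graphs are covered.\<close>

lemma Re_laplacian_form:
  fixes B :: "real mat"
  assumes B: "B \<in> carrier_mat m m" and x: "x \<in> carrier_vec m"
    and entries: "\<And>i j. i < m \<Longrightarrow> j < m \<Longrightarrow> B $$ (i, j) = (if i = j then d i else 0) - w i j"
  shows "Re ((map_mat complex_of_real B *\<^sub>v x) \<bullet>c x) =
    (\<Sum>i<m. d i * (cmod (x $ i))\<^sup>2) - (\<Sum>i<m. \<Sum>j<m. w i j * Re (x $ j * cnj (x $ i)))"
proof -
  have "Re ((map_mat complex_of_real B *\<^sub>v x) \<bullet>c x) =
      (\<Sum>i<m. \<Sum>j<m. ((if i = j then d i else 0) - w i j) * Re (x $ j * cnj (x $ i)))"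
    using B by (subst cscalar_prod_sum[OF _ x x])
      (auto simp: entries mult.assoc simp del: of_real_diff intro!: sum.cong)
  also have "\<dots> = (\<Sum>i<m. \<Sum>j<m. (if i = j then d i else 0) * Re (x $ j * cnj (x $ i))) -
      (\<Sum>i<m. \<Sum>j<m. w i j * Re (x $ j * cnj (x $ i)))"
    by (simp only: left_diff_distrib sum_subtractf)
  also have "(\<Sum>i<m. \<Sum>j<m. (if i = j then d i else 0) * Re (x $ j * cnj (x $ i))) =
      (\<Sum>i<m. d i * (cmod (x $ i))\<^sup>2)"
    by (intro sum.cong refl)
      (simp add: if_distrib[of "\<lambda>c. c * _"] cmod_power2 cong: if_cong flip: power2_eq_square)
  finally show ?thesis .
qed

text \<open>Pairwise 2 Re (x_j cnj x_i) <= |x_i|^2 + |x_j|^2, and by symmetry of \<open>w\<close>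
  the two squares contribute equally to the weighted degrees.\<close>

lemma laplacian_form_nonneg:
  fixes w :: "nat \<Rightarrow> nat \<Rightarrow> real" and x :: "complex vec"
  assumes sym: "\<And>i j. w i j = w j i" and w: "\<And>i j. 0 \<le> w i j"
  shows "(\<Sum>i<m. \<Sum>j<m. w i j * Re (x $ j * cnj (x $ i))) \<le> (\<Sum>i<m. (\<Sum>j<m. w i j) * (cmod (x $ i))\<^sup>2)"
proof -
  have le: "2 * Re (x $ j * cnj (x $ i)) \<le> (cmod (x $ i))\<^sup>2 + (cmod (x $ j))\<^sup>2" for i j
  proof -
    have "Re (x $ j * cnj (x $ i)) \<le> cmod (x $ i) * cmod (x $ j)"
      using complex_Re_le_cmod[of "x $ j * cnj (x $ i)"] by (simp add: norm_mult mult.commute)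
    then show ?thesis using sum_squares_bound[of "cmod (x $ i)" "cmod (x $ j)"] by simp
  qed
  have "2 * (\<Sum>i<m. \<Sum>j<m. w i j * Re (x $ j * cnj (x $ i))) =
      (\<Sum>i<m. \<Sum>j<m. w i j * (2 * Re (x $ j * cnj (x $ i))))"
    by (simp only: sum_distrib_left mult.left_commute)
  also have "\<dots> \<le> (\<Sum>i<m. \<Sum>j<m. w i j * ((cmod (x $ i))\<^sup>2 + (cmod (x $ j))\<^sup>2))"
    by (intro sum_mono mult_left_mono le w)
  also have "\<dots> = (\<Sum>i<m. \<Sum>j<m. w i j * (cmod (x $ i))\<^sup>2) + (\<Sum>i<m. \<Sum>j<m. w i j * (cmod (x $ j))\<^sup>2)"
    by (simp add: distrib_left sum.distrib)
  also have "(\<Sum>i<m. \<Sum>j<m. w i j * (cmod (x $ j))\<^sup>2) = (\<Sum>i<m. \<Sum>j<m. w i j * (cmod (x $ i))\<^sup>2)"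
    by (subst sum.swap) (simp add: sym)
  finally show ?thesis by (simp add: sum_distrib_right)
qed

section \<open>Entries of grounded Laplacians and degrees among the followers\<close>

text \<open>\<open>submatrix\<close> numbers its rows by \<open>pick\<close>; this turns sums over
  matrix indices into sums over followers.\<close>

lemma bij_betw_pick: "bij_betw (pick F) {..<card F} F" if "finite F"
proof -
  have "inj_on (pick F) {..<card F}"
    by (auto intro!: inj_onI) (metis linorder_neqE_nat order_less_irrefl pick_mono_le)
  moreover have "pick F ` {..<card F} \<subseteq> F" using pick_in_set_le by auto
  ultimately show ?thesis using that by (simp add: bij_betw_def card_image card_subset_eq)
qed

lemma grounded_laplacian_carrier:
  assumes "pverts G = {0..<n}"
  shows "grounded_laplacian n G S \<in> carrier_mat (card (pverts G - S)) (card (pverts G - S))"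
proof -
  have "{i. i < n \<and> i \<in> pverts G - S} = pverts G - S" using assms by auto
  then show ?thesis
    by (intro carrier_matI)
      (simp_all add: grounded_laplacian_def dim_submatrix laplacian_mat_def adjacency_mat_def)
qed

text \<open>The degree sum ranges over all \<open>n\<close> vertices: grounding deletes the leaders'
  rows and columns but keeps their share of the diagonal.\<close>

lemma grounded_laplacian_index:
  assumes verts: "pverts G = {0..<n}" and F: "F = pverts G - S"
    and i: "i < card F" and j: "j < card F"
  shows "grounded_laplacian n G S $$ (i, j) =
    (if i = j then \<Sum>v<n. if v \<rightarrow>\<^bsub>G\<^esub> pick F i then 1 else 0 else 0) -
    (if pick F j \<rightarrow>\<^bsub>G\<^esub> pick F i then 1 else 0)"
proof -
  have finF: "finite F" using verts F by simp
  have "{i. i < n \<and> i \<in> F} = F" using verts F by auto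
  then have "grounded_laplacian n G S $$ (i, j) = laplacian_mat n G $$ (pick F i, pick F j)"
    using i j unfolding grounded_laplacian_def F[symmetric]
    by (intro submatrix_index) (simp_all add: laplacian_mat_def adjacency_mat_def)
  moreover have "pick F i < n" "pick F j < n"
    using pick_in_set_le[OF i] pick_in_set_le[OF j] verts F by auto
  moreover have "pick F i = pick F j \<longleftrightarrow> i = j"
    using bij_betw_pick[OF finF] i j by (auto simp: bij_betw_def inj_on_eq_iff)
  ultimately show ?thesis by (simp add: laplacian_mat_def mat_diag_def adjacency_mat_def)
qed

lemma in_degree_restrict:
  fixes G :: "nat pair_pre_digraph"
  assumes "finite F" "v \<in> F"
  shows "real (in_degree (G \<restriction> F) v) = (\<Sum>u\<in>F. if u \<rightarrow>\<^bsub>G\<^esub> v then 1 else 0)"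
proof -
  have "in_arcs (G \<restriction> F) v = (\<lambda>u. (u, v)) ` {u \<in> F. u \<rightarrow>\<^bsub>G\<^esub> v}"
    using assms by (auto simp: in_arcs_def arcs_ends_conv)
  then have "in_degree (G \<restriction> F) v = card {u \<in> F. u \<rightarrow>\<^bsub>G\<^esub> v}"
    by (simp add: in_degree_def card_image inj_on_def)
  then show ?thesis using assms by (simp add: sum.If_cases Int_def)
qed

lemma out_degree_restrict:
  fixes G :: "nat pair_pre_digraph"
  assumes "finite F" "v \<in> F"
  shows "real (out_degree (G \<restriction> F) v) = (\<Sum>u\<in>F. if v \<rightarrow>\<^bsub>G\<^esub> u then 1 else 0)"
proof -
  have "out_arcs (G \<restriction> F) v = (\<lambda>u. (v, u)) ` {u \<in> F. v \<rightarrow>\<^bsub>G\<^esub> u}"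
    using assms by (auto simp: out_arcs_def arcs_ends_conv)
  then have "out_degree (G \<restriction> F) v = card {u \<in> F. v \<rightarrow>\<^bsub>G\<^esub> u}"
    by (simp add: out_degree_def card_image inj_on_def)
  then show ?thesis using assms by (simp add: sum.If_cases Int_def)
qed

lemma parcs_mk_symmetric_pair_iff:
  fixes G :: "nat pair_pre_digraph"
  shows "(u, v) \<in> parcs (mk_symmetric G) \<longleftrightarrow> (u, v) \<in> parcs G \<or> (v, u) \<in> parcs G"
  by (auto simp: parcs_mk_symmetric intro: rev_bexI)

section \<open>Comparison of the directed and undirected quadratic forms\<close>

theorem theorem6:
  fixes G :: "nat pair_pre_digraph" and n :: nat and S :: "nat set"
  assumes "pair_digraph G"
    and "pverts G = {0..<n}"
    and "\<And>u v. u \<rightarrow>\<^bsub>G\<^esub> v \<Longrightarrow> \<not> v \<rightarrow>\<^bsub>G\<^esub> u"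
    and "S \<subseteq> pverts G" and "S \<noteq> {}" and "pverts G - S \<noteq> {}"
    and "\<And>v. v \<in> S \<Longrightarrow> in_degree G v = 0"
    and "\<And>v. v \<in> pverts G - S \<Longrightarrow> \<exists>s \<in> S. s \<rightarrow>\<^sup>*\<^bsub>G\<^esub> v"
    and "balanced (G \<restriction> (pverts G - S))"
  shows "hinf_norm (grounded_laplacian n G S)
           \<le> 2 * hinf_norm (grounded_laplacian n (mk_symmetric G) S)"
proof -
  interpret pair_digraph G by fact
  define F where "F = pverts G - S"
  define m where "m = card F"
  define p where "p = pick F"
  \<comment> \<open>The first index is the head of the arc, as in
    \<open>adjacency_mat\<close>.\<close>
  define A :: "nat \<Rightarrow> nat \<Rightarrow> real" where "A u v = (if v \<rightarrow>\<^bsub>G\<^esub> u then 1 else 0)" for u v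
  define a where "a i j = A (p i) (p j)" for i j
  define w where "w i j = a i j + a j i" for i j
  define k where "k i = (\<Sum>v\<in>S. A (p i) v)" for i
  define L where "L = grounded_laplacian n G S"
  define U where "U = grounded_laplacian n (mk_symmetric G) S"
  have F: "finite F" "F \<noteq> {}" using assms(2,6) by (auto simp: F_def)
  have m: "0 < m" using F by (simp add: m_def card_gt_0_iff)
  have pF: "p i \<in> F" if "i < m" for i
    using that pick_in_set_le by (simp add: p_def m_def)
  have sum_p: "(\<Sum>j<m. f (p j)) = (\<Sum>v\<in>F. f v)" for f :: "nat \<Rightarrow> real"
    unfolding p_def m_def by (rule sum.reindex_bij_betw[OF bij_betw_pick[OF F(1)]])
  have split: "(\<Sum>v<n. f v) = (\<Sum>j<m. f (p j)) + (\<Sum>v\<in>S. f v)" for f :: "nat \<Rightarrow> real"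
  proof -
    have "{..<n} = F \<union> S" "F \<inter> S = {}" "finite S"
      using assms(2,4) finite_subset by (auto simp: F_def)
    then show ?thesis using F(1) by (simp add: sum_p sum.union_disjoint)
  qed
  \<comment> \<open>In-degree is a cardinality, and \<open>card\<close> is also zero on infinite
    sets, so finiteness of the arc set is invoked.\<close>
  have no_arc_into_S: "\<not> u \<rightarrow>\<^bsub>G\<^esub> v" if "v \<in> S" for u v
    using assms(7)[OF that] finite_in_arcs[of v] by (force simp: in_degree_def in_arcs_def arcs_ends_conv)
  have bal: "(\<Sum>j<m. a i j) = (\<Sum>j<m. a j i)" if "i < m" for i
  proof -
    have "in_degree (G \<restriction> F) (p i) = out_degree (G \<restriction> F) (p i)"
      using assms(9) pF[OF that] by (simp add: balanced_def F_def)
    then have "(\<Sum>v\<in>F. A (p i) v) = (\<Sum>v\<in>F. A v (p i))"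
      using in_degree_restrict[OF F(1) pF[OF that], of G] out_degree_restrict[OF F(1) pF[OF that], of G]
      by (simp add: A_def)
    then show ?thesis
      using sum_p[of "A (p i)"] sum_p[of "\<lambda>v. A v (p i)"] by (simp add: a_def)
  qed
  have a_nonneg: "0 \<le> a i j" and k_nonneg: "0 \<le> k i" for i j
    by (simp_all add: a_def k_def A_def sum_nonneg)
  have L: "L \<in> carrier_mat m m"
    unfolding L_def m_def F_def by (rule grounded_laplacian_carrier[OF assms(2)])
  have L_entry: "L $$ (i, j) = (if i = j then (\<Sum>j<m. a i j) + k i else 0) - a i j"
    if "i < m" "j < m" for i j
    using grounded_laplacian_index[OF assms(2) F_def that[unfolded m_def]] split[of "A (p i)"]
    by (cases "i = j") (simp_all add: L_def a_def k_def A_def p_def)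
  have verts_sym: "pverts (mk_symmetric G) = {0..<n}" using assms(2) by simp
  have U: "U \<in> carrier_mat m m"
    using grounded_laplacian_carrier[OF verts_sym, of S] by (simp add: U_def m_def F_def)
  have F_sym: "F = pverts (mk_symmetric G) - S" by (simp add: F_def)
  \<comment> \<open>Arcs are never bidirectional, so at most one summand is
    \<open>1\<close>.\<close>
  have A_sym: "(if v \<rightarrow>\<^bsub>mk_symmetric G\<^esub> u then 1 else 0) = A u v + A v u" for u v
    using assms(3)[of u v] by (auto simp: A_def parcs_mk_symmetric_pair_iff)
  have U_entry: "U $$ (i, j) = (if i = j then (\<Sum>j<m. w i j) + k i else 0) - w i j"
    if "i < m" "j < m" for i j
  proof -
    \<comment> \<open>No follower has an arc to a leader, so the leaders add the same
      \<open>k i\<close> to the undirected degree as to the in-degree.\<close>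
    have "(\<Sum>v\<in>S. A v (p i)) = 0" using no_arc_into_S by (simp add: A_def)
    then have "(\<Sum>v<n. A (p i) v + A v (p i)) = (\<Sum>j<m. w i j) + k i"
      unfolding split by (simp add: w_def a_def k_def sum.distrib)
    then show ?thesis
      using grounded_laplacian_index[OF verts_sym F_sym that[unfolded m_def]]
      unfolding A_sym by (cases "i = j") (simp_all add: U_def w_def a_def p_def)
  qed
  let ?q = "\<lambda>B x. Re ((map_mat complex_of_real B *\<^sub>v x) \<bullet>c x)"
  have qU: "?q U x = (\<Sum>i<m. ((\<Sum>j<m. w i j) + k i) * (cmod (x $ i))\<^sup>2) -
      (\<Sum>i<m. \<Sum>j<m. w i j * Re (x $ j * cnj (x $ i)))" if "x \<in> carrier_vec m" for x
    by (rule Re_laplacian_form[OF U that U_entry])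
  have qL: "?q L x = (\<Sum>i<m. ((\<Sum>j<m. a i j) + k i) * (cmod (x $ i))\<^sup>2) -
      (\<Sum>i<m. \<Sum>j<m. a i j * Re (x $ j * cnj (x $ i)))" if "x \<in> carrier_vec m" for x
    by (rule Re_laplacian_form[OF L that L_entry])
  have qU_le: "?q U x \<le> 2 * ?q L x" if x: "x \<in> carrier_vec m" for x
  proof -
    let ?c = "\<lambda>i j. Re (x $ j * cnj (x $ i))" and ?n = "\<lambda>i. (cmod (x $ i))\<^sup>2"
    \<comment> \<open>\<open>?c\<close> is symmetric in its indices, so \<open>a\<close> and its
      transpose give the same form.\<close>
    have "(\<Sum>i<m. \<Sum>j<m. a j i * ?c i j) = (\<Sum>i<m. \<Sum>j<m. a i j * ?c i j)"
      by (subst sum.swap) (simp add: mult_ac)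
    then have off: "(\<Sum>i<m. \<Sum>j<m. w i j * ?c i j) = 2 * (\<Sum>i<m. \<Sum>j<m. a i j * ?c i j)"
      by (simp only: w_def distrib_right sum.distrib)
    \<comment> \<open>By balancedness the row sum of \<open>w\<close> is twice that of
      \<open>a\<close>; the slack is exactly \<open>k i\<close>.\<close>
    have "(\<Sum>j<m. w i j) + k i \<le> 2 * ((\<Sum>j<m. a i j) + k i)" if "i < m" for i
      using bal[OF that] k_nonneg[of i] by (simp add: w_def sum.distrib)
    then have "(\<Sum>i<m. ((\<Sum>j<m. w i j) + k i) * ?n i) \<le> (\<Sum>i<m. 2 * ((\<Sum>j<m. a i j) + k i) * ?n i)"
      by (intro sum_mono mult_right_mono) auto
    also have "\<dots> = 2 * (\<Sum>i<m. ((\<Sum>j<m. a i j) + k i) * ?n i)"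
      by (simp only: sum_distrib_left mult.assoc)
    finally show ?thesis
      unfolding qU[OF x] qL[OF x] off by simp
  qed
  have U_sym: "U $$ (i, j) = U $$ (j, i)" if "i < m" "j < m" for i j
    using that by (auto simp: U_entry w_def)
  have U_psd: "0 \<le> ?q U x" if x: "x \<in> carrier_vec m" for x
  proof -
    \<comment> \<open>The form of \<open>U\<close> is the Laplacian form of \<open>w\<close> plus
      this diagonal term.\<close>
    have "0 \<le> (\<Sum>i<m. k i * (cmod (x $ i))\<^sup>2)" by (simp add: sum_nonneg k_nonneg)
    then show ?thesis
      using laplacian_form_nonneg[of w x m] a_nonneg
      unfolding qU[OF x] distrib_right sum.distrib by (simp add: w_def add.commute)
  qed
  have "hinf_norm L \<le> 2 * hinf_norm U"
  proof (rule hinf_norm_ge_of_psd[OF U m U_sym U_psd])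
    assume "hinf_norm U = \<infinity>"
    then show ?thesis by simp
  next
    fix t :: real
    assume t: "0 < t" "ereal (1 / t) \<le> hinf_norm U"
      and coercive: "\<And>x. x \<in> carrier_vec m \<Longrightarrow> t * Re (x \<bullet>c x) \<le> ?q U x"
    \<comment> \<open>Halving the coercivity constant is the source of the factor 2 in the
      theorem.\<close>
    have "t / 2 * Re (x \<bullet>c x) \<le> ?q L x" if "x \<in> carrier_vec m" for x
      using coercive[OF that] qU_le[OF that] by linarith
    then have "hinf_norm L \<le> ereal (1 / (t / 2))"
      using t(1) by (intro hinf_norm_le_of_coercive[OF L m]) simp_all
    also have "\<dots> = 2 * ereal (1 / t)" by simp
    also have "\<dots> \<le> 2 * hinf_norm U" by (intro ereal_mult_left_mono t(2)) simp
    finally show ?thesis .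
  qed auto
  then show ?thesis by (simp only: L_def U_def)
qed

end
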